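(* Let $G$ be an oriented unicyclic graph on $n\ge 2$ vertices $1,\dots,n$ with edges $e_1,\dots,e_n$, with odd cycle $C$, non-zero edge weights in $\mathbb{C}\setminus\mathbb{R}^-$, and complex signless incidence matrix $N$. Suppose $wt(C)\in\mathbb{C}\setminus\mathbb{R}^-$. Define the $n\times n$ matrix $H=(h_{ij})$ by, for $e_i=(u,v)$, $$h_{ij}=\begin{cases}(-1)^{d^*(j,u)}\dfrac{\frac{wt(\gamma_{u\to j})}{|wt(\gamma_{u\to j})|}}{\sqrt{\overline{w_{uv}}}\left(\frac{w_{uv}}{|w_{uv}|}+\frac{wt(\gamma_{u\to v})}{|wt(\gamma_{u\to v})|}\right)} & \text{if } e_i\in C,\\[3mm] 0 & \text{if } e_i\notin C,\ j\in G\setminus e_i[C],\\[1mm] (-1)^{d^*(j,u)}\dfrac{1}{\sqrt{w_{uv}}}\dfrac{|wt(\gamma_{j\to u})|}{wt(\gamma_{j\to u})} & \text{if } e_i\notin C,\ j\in G\setminus(e_i,u](C),\\[3mm] (-1)^{d^*(j,v)}\dfrac{1}{\sqrt{\overline{w_{uv}}}}\dfrac{|wt(\gamma_{j\to v})|}{wt(\gamma_{j\to v})} & \text{if } e_i\notin C,\ j\in G\setminus(e_i,v](C).\end{cases}$$ Then $H$ is the Moore--Penrose inverse of $N$.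
   Context: An oriented graph $G$ is obtained from a finite simple undirected graph $G_u$ (its underlying graph) by giving each edge exactly one direction. It is unicyclic if $G_u$ is connected and has exactly one cycle (so it has as many edges as vertices). Each directed edge $(u,v)$ (from $u$ to $v$) has a non-zero complex weight $w_{uv}$. $\mathbb{R}^-$ denotes the negative real numbers, and $\sqrt{\cdot}$ is the principal square root. The complex signless incidence matrix $N=(n_{ij})$ (rows indexed by vertices, columns by edges) is given, for $e_j=(u,v)$, by $n_{ij}=\sqrt{w_{uv}}$ if $i=u$, $n_{ij}=\sqrt{\overline{w_{uv}}}$ if $i=v$, and $n_{ij}=0$ otherwise. Put $a_{ij}=w_{ij}$ if $(i,j)\in E(G)$, $a_{ij}=\overline{w_{ji}}$ if $(j,i)\in E(G)$, and $a_{ij}=0$ otherwise. The weight of a walk $\gamma=(i_1,\dots,i_k)$ in $G_u$ is $wt(\gamma)=\prod_{s=1}^{k-1}a_{i_si_{s+1}}$ (so a trivial one-vertex walk has weight $1$). $wt(C)$ is the weight of the closed walk going once around $C$ in either direction (the two directions give complex conjugate values, so the condition on $wt(C)$ does not depend on the choice). A cycle is odd if its length is odd. If $e_i=(u,v)\notin C$, removing $e_i$ from $G$ leaves two components: a unicyclic one, denoted $G\setminus e_i[C]$, and a tree; the tree is denoted $G\setminus(e_i,u](C)$ if it contains $u$ and $G\setminus(e_i,v](C)$ if it contains $v$. For vertices $s,r$, $d^*(s,r)$ and $\gamma_{s\to r}$ denote the distance and the unique walk without repeated vertices from $s$ to $r$ in the underlying graph of $G$ with $e_i$ removed (if $e_i\in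 C$ this is a tree; if $e_i\notin C$ they are only used inside its tree component). *)

theory Defs
  imports
    "HOL-Analysis.Analysis"
    "Jordan_Normal_Form.Schur_Decomposition"
    "Graph_Theory.Graph_Theory"
begin

locale oriented_graph = digraph G for G :: "('a, 'b) pre_digraph" +
  assumes no_opposite_arcs: "(u, v) \<in> arcs_ends G \<Longrightarrow> (v, u) \<notin> arcs_ends G"

abbreviation underlying :: "('a, 'b) pre_digraph \<Rightarrow> ('a, 'a \<times> 'a) pre_digraph" where
  "underlying G \<equiv> with_proj (mk_symmetric G)"

text \<open>Walks are the vertex lists of \<^const>\<open>vwalk\<close>. A cycle is traversed by a closed walk
  \<open>[v\<^sub>0, \<dots>, v\<^sub>k]\<close> with \<open>v\<^sub>0 = v\<^sub>k\<close>; the bound \<open>3 \<le> k\<close> excludes going back and forth along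
  one edge. The cycle itself, independent of starting point and direction, is
  identified with its set of edges.\<close>

definition cycle_walk :: "('a, 'b) pre_digraph \<Rightarrow> 'a vwalk \<Rightarrow> bool" where
  "cycle_walk G c \<longleftrightarrow>
     vwalk c (underlying G) \<and> hd c = last c \<and> distinct (tl c) \<and> 3 \<le> vwalk_length c"

definition walk_edges :: "('a, 'b) pre_digraph \<Rightarrow> 'a vwalk \<Rightarrow> 'b set" where
  "walk_edges G p = {e \<in> arcs G. (tail G e, head G e) \<in> set (vwalk_arcs p) \<or>
                                 (head G e, tail G e) \<in> set (vwalk_arcs p)}"

definition unicyclic :: "('a, 'b) pre_digraph \<Rightarrow> bool" where
  "unicyclic G \<longleftrightarrow>
     Digraph_Component.connected G \<and> (\<exists>!C. \<exists>c. cycle_walk G c \<and> C = walk_edges G c)"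

definition neg_reals :: "complex set" where
  "neg_reals = complex_of_real ` {..<0}"

text \<open>The weight of the arc from \<open>u\<close> to \<open>v\<close> is \<open>w u v\<close>; values of \<open>w\<close> elsewhere are never used.\<close>

definition adj_weight :: "('a, 'b) pre_digraph \<Rightarrow> ('a \<Rightarrow> 'a \<Rightarrow> complex) \<Rightarrow> 'a \<Rightarrow> 'a \<Rightarrow> complex" where
  "adj_weight G w i j =
     (if (i, j) \<in> arcs_ends G then w i j
      else if (j, i) \<in> arcs_ends G then cnj (w j i)
      else 0)"

definition walk_weight :: "('a, 'b) pre_digraph \<Rightarrow> ('a \<Rightarrow> 'a \<Rightarrow> complex) \<Rightarrow> 'a vwalk \<Rightarrow> complex" where
  "walk_weight G w p = (\<Prod>(i, j)\<leftarrow>vwalk_arcs p. adj_weight G w i j)"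

definition edge_removed :: "('a, 'b) pre_digraph \<Rightarrow> 'b \<Rightarrow> ('a, 'a \<times> 'a) pre_digraph" where
  "edge_removed G e = underlying (pre_digraph.del_arc G e)"

definition dist_star :: "('a, 'b) pre_digraph \<Rightarrow> 'b \<Rightarrow> 'a \<Rightarrow> 'a \<Rightarrow> nat" where
  "dist_star G e s r =
     (LEAST k. \<exists>p. vwalk p (edge_removed G e) \<and> hd p = s \<and> last p = r \<and> vwalk_length p = k)"

definition path_star :: "('a, 'b) pre_digraph \<Rightarrow> 'b \<Rightarrow> 'a \<Rightarrow> 'a \<Rightarrow> 'a vwalk" where
  "path_star G e s r = (THE p. vpath p (edge_removed G e) \<and> hd p = s \<and> last p = r)"

text \<open>For an edge \<open>e\<close> off the cycle \<open>c\<close>: the vertices of the component of \<open>G - e\<close> containing the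
  cycle, and those of the other component, provided \<open>x\<close> lies in it (and \<open>{}\<close> otherwise).\<close>

definition unicyclic_part :: "('a, 'b) pre_digraph \<Rightarrow> 'a vwalk \<Rightarrow> 'b \<Rightarrow> 'a set" where
  "unicyclic_part G c e = {j. \<exists>s \<in> set c. s \<rightarrow>\<^sup>*\<^bsub>edge_removed G e\<^esub> j}"

definition tree_part :: "('a, 'b) pre_digraph \<Rightarrow> 'a vwalk \<Rightarrow> 'b \<Rightarrow> 'a \<Rightarrow> 'a set" where
  "tree_part G c e x =
     (if x \<in> unicyclic_part G c e then {} else {j. x \<rightarrow>\<^sup>*\<^bsub>edge_removed G e\<^esub> j})"

text \<open>Vertices and edges are both numbered \<open>0, \<dots>, n - 1\<close>, the index range of
  \<^typ>\<open>complex mat\<close>; the edge \<open>i\<close> runs from \<open>tail G i\<close> to \<open>head G i\<close>.\<close>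

definition signless_incidence ::
  "nat \<Rightarrow> (nat, nat) pre_digraph \<Rightarrow> (nat \<Rightarrow> nat \<Rightarrow> complex) \<Rightarrow> complex mat" where
  "signless_incidence n G w = mat n n (\<lambda>(i, j).
     let u = tail G j; v = head G j in
       if i = u then csqrt (w u v)
       else if i = v then csqrt (cnj (w u v))
       else 0)"

definition H_matrix ::
  "nat \<Rightarrow> (nat, nat) pre_digraph \<Rightarrow> (nat \<Rightarrow> nat \<Rightarrow> complex) \<Rightarrow> nat vwalk \<Rightarrow> complex mat" where
  "H_matrix n G w c = mat n n (\<lambda>(i, j).
     let u = tail G i; v = head G i;
         d = dist_star G i;
         wt = (\<lambda>s r. walk_weight G w (path_star G i s r));
         md = (\<lambda>z. complex_of_real (cmod z))
     in
       if i \<in> walk_edges G c then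
         (-1) ^ d j u * ((wt u j / md (wt u j)) /
           (csqrt (cnj (w u v)) * (w u v / md (w u v) + wt u v / md (wt u v))))
       else if j \<in> unicyclic_part G c i then 0
       else if j \<in> tree_part G c i u then
         (-1) ^ d j u * (1 / csqrt (w u v)) * (md (wt j u) / wt j u)
       else if j \<in> tree_part G c i v then
         (-1) ^ d j v * (1 / csqrt (cnj (w u v))) * (md (wt j v) / wt j v)
       else 0)"

definition is_moore_penrose_inverse :: "complex mat \<Rightarrow> complex mat \<Rightarrow> bool" where
  "is_moore_penrose_inverse A X \<longleftrightarrow>
     X \<in> carrier_mat (dim_col A) (dim_row A) \<and>
     A * X * A = A \<and>
     X * A * X = X \<and>
     mat_adjoint (A * X) = A * X \<and>
     mat_adjoint (X * A) = X * A"

end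

theory Submission
  imports Defs
begin

text \<open>
  Since \<open>N\<close> is square, it suffices to show \<open>H N = 1\<close>. A column of \<open>N\<close> has only two non-zero
  entries, at the ends \<open>a\<close>, \<open>b\<close> of the edge \<open>k\<close>, so that the entry \<open>(i, k)\<close> of \<open>H N\<close> is
  \<open>h\<^sub>i\<^sub>a s + h\<^sub>i\<^sub>b s'\<close>, where \<open>s\<close> is the square root of the weight and \<open>s'\<close> its conjugate.
  Deleting edge \<open>i\<close> from \<open>G\<close> leaves a tree on which row \<open>i\<close> of \<open>H\<close> is, up to a factor, the
  product of the negated unit weights along the tree path from an end of \<open>i\<close>; off this tree the
  row vanishes. For \<open>k \<noteq> i\<close> the tree paths to \<open>a\<close> and \<open>b\<close> differ by the edge \<open>k\<close> alone, and the two
  terms cancel because \<open>(s\<^sup>2 / \<bar>s\<bar>\<^sup>2) s' = s\<close>. For \<open>k = i\<close> the factor makes the entry equal to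
  \<open>1\<close>; on the cycle this uses that \<open>wt(C)\<close> is not a negative real, so that the denominator does
  not vanish, and that \<open>C\<close> is odd, so that the two ends have the same sign.
\<close>

section \<open>Paths in an acyclic component\<close>

lemma length_vwalk_to_vpath: "length (vwalk_to_vpath p) \<le> length p"
proof (induction p rule: vwalk_to_vpath_induct3)
  case (in_set x xs)
  then show ?case
    using length_dropWhile_le[of "\<lambda>y. y \<noteq> x" xs] by simp
qed auto

text \<open>Cycles are excluded only from the component of the root \<open>x\<close>: after the
  removal of an edge off the cycle, the other component still contains the cycle. In this form the
  locale serves edges on and off the cycle alike.\<close>

locale acyclic_component = loopfree_digraph F for F :: "('a, 'b) pre_digraph" +
  fixes x :: 'a
  assumes sym: "symmetric F"
    and root: "x \<in> verts F"
    and acyclic: "\<lbrakk>vwalk c F; hd c = last c; distinct (tl c); 3 \<le> vwalk_length c\<rbrakk>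
      \<Longrightarrow> \<not> x \<rightarrow>\<^sup>*\<^bsub>F\<^esub> hd c"
begin

text \<open>The segment of \<open>p\<close> from \<open>b\<close> on, closed up by the edge from
  \<open>last p\<close> to \<open>b\<close>, has \<open>length p2 + 1\<close> edges. It would be a
  cycle reachable from \<open>x\<close> unless \<open>b\<close> is the last vertex but one of
  \<open>p\<close>.\<close>

lemma vpath_extend:
  assumes p: "vpath p F" "hd p = x" and b: "(last p, b) \<in> arcs_ends F" "b \<in> set p"
  shows "\<exists>p'. p' \<noteq> [] \<and> p = p' @ [last p] \<and> last p' = b"
proof -
  obtain p1 p2 where split: "p = p1 @ b # p2"
    using b(2) by (meson split_list)
  have "last p \<noteq> b"
    using b(1) adj_not_same by auto
  then have p2: "p2 \<noteq> []"
    using split by auto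
  have vw: "vwalk p F" "distinct p"
    using p(1) unfolding vpath_def by simp_all
  have vwb: "vwalk (b # p2) F"
    using vw split vwalkI_append_r[of "b # p2" p1 F] by simp
  have cyc: "vwalk ((b # p2) @ [b]) F"
    using vwb b(1) split p2 set_vwalk_arcs_snoc[of "b # p2" b] unfolding vwalk_def by simp
  have "x \<rightarrow>\<^sup>*\<^bsub>F\<^esub> b"
  proof -
    have "vwalk (p1 @ [b]) F"
      using vw(1) split vwalkI_append_l[of "p1 @ [b]" p2 F] by simp
    moreover have "hd (p1 @ [b]) = x"
      using p(2) split by (cases p1) auto
    ultimately show ?thesis
      unfolding reachable_vwalk_conv by (intro exI[of _ "p1 @ [b]"]) simp
  qed
  then have "\<not> 3 \<le> vwalk_length ((b # p2) @ [b])"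
    using acyclic[OF cyc] vw split by auto
  then have "length p2 = Suc 0"
    using p2 by (cases p2) (auto simp: not_less_eq_eq)
  then obtain y where "p2 = [y]"
    by (auto simp: length_Suc_conv)
  then show ?thesis
    using split by (intro exI[of _ "p1 @ [b]"]) simp
qed

text \<open>Walk along \<open>r\<close> from the common end: at each step the path \<open>p\<close> either loses its last
  vertex or is extended by the next vertex of \<open>r\<close>, and an extension would make \<open>r\<close> return to a
  vertex that it has left.\<close>

lemma vpath_rev_unique:
  assumes "vpath r F" "last r = x" "vpath p F" "hd p = x" "hd r = last p"
  shows "r = rev p"
  using assms
proof (induction r arbitrary: p)
  case Nil
  then show ?case by auto
next
  case (Cons y r)
  show ?case
  proof (cases r)
    case Nil
    with Cons.prems have "last p = x" by simp
    then have "p = [x]"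
      using Cons.prems(3,4) by (cases p) (auto simp: vpath_def split: if_splits)
    with Cons.prems Nil show ?thesis by simp
  next
    case (Cons b r')
    have r: "vpath r F" "(y, b) \<in> arcs_ends F" "y \<notin> set r" "last r = x" "hd r = b"
      using Cons.prems(1,2) Cons by (auto simp: vpath_def vwalk_def)
    have y: "last p = y"
      using Cons.prems by simp
    show ?thesis
    proof (cases "b \<in> set p")
      case True
      then obtain p' where p': "p' \<noteq> []" "p = p' @ [y]" "last p' = b"
        using vpath_extend[of p b] Cons.prems r y by auto
      have "vpath p' F" "hd p' = x"
        using Cons.prems(3,4) p' by (auto simp: vpath_def intro: vwalkI_append_l)
      then have "r = rev p'"
        using Cons.IH r p' by auto
      then show ?thesis using p' by simp
    next
      case False
      have "vpath (p @ [b]) F"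
        using Cons.prems(3) False r(2) y
        by (auto simp: vpath_def vwalk_def set_vwalk_arcs_snoc)
      moreover have "hd (p @ [b]) = x"
        using Cons.prems(3,4) by (auto simp: vpath_def vwalk_def hd_append)
      ultimately have "r = rev (p @ [b])"
        using Cons.IH r by auto
      moreover have "y \<in> set p"
        using y Cons.prems(3) by (auto simp: vpath_def vwalk_def)
      ultimately show ?thesis using r(3) by simp
    qed
  qed
qed

lemma vpath_rev:
  assumes "vpath p F"
  shows "vpath (rev p) F"
  using assms vwalk_rev_ex[OF sym] by (auto simp: vpath_def)

lemma hd_last_rev:
  assumes "vpath p F"
  shows "hd (rev p) = last p" "last (rev p) = hd p"
  using assms by (auto simp: vpath_def vwalk_def hd_rev last_rev)

lemma vpath_unique:
  assumes "vpath p F" "hd p = x" "vpath q F" "hd q = x" "last p = last q"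
  shows "p = q"
  using vpath_rev_unique[of "rev p" q] assms vpath_rev hd_last_rev by auto

definition root_path :: "'a \<Rightarrow> 'a vwalk" where
  "root_path j = (THE p. vpath p F \<and> hd p = x \<and> last p = j)"

lemma root_path_eqI:
  assumes "vpath p F" "hd p = x" "last p = j"
  shows "root_path j = p"
  unfolding root_path_def using assms vpath_unique by (intro the_equality) auto

lemma root_path:
  assumes "x \<rightarrow>\<^sup>*\<^bsub>F\<^esub> j"
  shows "vpath (root_path j) F" "hd (root_path j) = x" "last (root_path j) = j"
    "root_path j \<noteq> []"
proof -
  obtain p where p: "vpath p F" "hd p = x" "last p = j"
    using assms unfolding reachable_vpath_conv by blast
  moreover have "root_path j = p"
    using p by (rule root_path_eqI)
  ultimately show "vpath (root_path j) F" "hd (root_path j) = x" "last (root_path j) = j"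
    "root_path j \<noteq> []"
    by auto
qed

lemma root_path_root: "root_path x = [x]"
  using root by (intro root_path_eqI) (auto simp: vpath_def)

text \<open>If \<open>b\<close> lies on the path to \<open>a\<close>, then by
  \<open>vpath_extend\<close> it comes just before \<open>a\<close>; if not, appending
  \<open>b\<close> gives a path. This is what makes the two terms of an off-diagonal entry
  comparable.\<close>

lemma root_path_adj:
  assumes j: "x \<rightarrow>\<^sup>*\<^bsub>F\<^esub> a" and ab: "(a, b) \<in> arcs_ends F"
  shows "root_path b = root_path a @ [b] \<or> root_path a = root_path b @ [a]"
proof (cases "b \<in> set (root_path a)")
  case True
  then obtain p' where p': "p' \<noteq> []" "root_path a = p' @ [a]" "last p' = b"
    using vpath_extend[of "root_path a" b] root_path[OF j] ab by auto
  then have "root_path b = p'"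
    using root_path[OF j] p' by (intro root_path_eqI) (auto simp: vpath_def intro: vwalkI_append_l)
  then show ?thesis using p' by simp
next
  case False
  have "root_path b = root_path a @ [b]"
    using root_path[OF j] False ab
    by (intro root_path_eqI) (auto simp: vpath_def vwalk_def set_vwalk_arcs_snoc hd_append)
  then show ?thesis by simp
qed

lemma path_to_root:
  assumes j: "x \<rightarrow>\<^sup>*\<^bsub>F\<^esub> j"
  shows "(THE p. vpath p F \<and> hd p = j \<and> last p = x) = rev (root_path j)"
proof (rule the_equality)
  show "vpath (rev (root_path j)) F \<and> hd (rev (root_path j)) = j \<and> last (rev (root_path j)) = x"
    using root_path[OF j] vpath_rev hd_last_rev by simp
next
  fix p
  assume "vpath p F \<and> hd p = j \<and> last p = x"
  then show "p = rev (root_path j)"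
    using root_path[OF j] by (intro vpath_rev_unique) simp_all
qed

text \<open>Every walk shortens to a path with the same ends, and there is only one such
  path.\<close>

lemma dist_to_root:
  assumes j: "x \<rightarrow>\<^sup>*\<^bsub>F\<^esub> j"
  shows "(LEAST k. \<exists>p. vwalk p F \<and> hd p = j \<and> last p = x \<and> vwalk_length p = k)
    = vwalk_length (root_path j)"
proof (rule Least_equality)
  show "\<exists>p. vwalk p F \<and> hd p = j \<and> last p = x \<and> vwalk_length p = vwalk_length (root_path j)"
    using root_path[OF j] vpath_rev[of "root_path j"] hd_last_rev[of "root_path j"]
    by (intro exI[of _ "rev (root_path j)"]) (simp add: vpath_def)
next
  fix k
  assume "\<exists>p. vwalk p F \<and> hd p = j \<and> last p = x \<and> vwalk_length p = k"
  then obtain p where p: "vwalk p F" "hd p = j" "last p = x" "vwalk_length p = k"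
    by auto
  then have "vwalk_to_vpath p = rev (root_path j)"
    using root_path[OF j]
    by (intro vpath_rev_unique)
      (simp_all add: vwalk_to_vpath_hd vwalk_to_vpath_last vwalk_to_vpath_vpath)
  then have "length (root_path j) \<le> length p"
    using length_vwalk_to_vpath[of p] by simp
  then show "vwalk_length (root_path j) \<le> k"
    using p(4) by simp
qed

end

section \<open>Principal square roots and phases\<close>

lemma sgn_cnj: "sgn (cnj z) = cnj (sgn z)"
  by (simp add: sgn_eq)

text \<open>The principal root commutes with conjugation off its branch cut, the negative reals.
  Zero needs its own case because \<open>neg_reals\<close> omits it while \<open>cnj_csqrt\<close>
  is applied off the closed half-line.\<close>

lemma csqrt_cnj:
  assumes "z \<notin> neg_reals"
  shows "csqrt (cnj z) = cnj (csqrt z)"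
proof (cases "z = 0")
  case False
  have "z \<notin> \<real>\<^sub>\<le>\<^sub>0"
  proof
    assume "z \<in> \<real>\<^sub>\<le>\<^sub>0"
    then obtain r where "z = complex_of_real r" "r \<le> 0"
      by (auto simp: nonpos_Reals_def)
    with False assms show False
      by (auto simp: neg_reals_def)
  qed
  then show ?thesis by (simp add: cnj_csqrt)
qed simp

text \<open>With \<open>s = csqrt z\<close> non-zero, the phase of \<open>z\<close> is
  \<open>s / cnj s\<close>. This identity and its conjugate carry the cancellation off the
  diagonal.\<close>

lemma sgn_mult_cnj_csqrt: "sgn z * cnj (csqrt z) = csqrt z"
proof (cases "z = 0")
  case False
  define s where "s = csqrt z"
  have z: "z = s * s"
    using power2_csqrt[of z] by (simp add: power2_eq_square s_def)
  have "s \<noteq> 0"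
    using False z by auto
  moreover have "complex_of_real (cmod s) * complex_of_real (cmod s) = s * cnj s"
    using complex_norm_square[of s] by (simp add: power2_eq_square)
  ultimately have "sgn s * sgn s * cnj s = s"
    by (simp add: sgn_eq field_simps)
  then show ?thesis
    unfolding s_def[symmetric] by (simp add: z sgn_mult)
qed simp

lemma sgn_cnj_mult_csqrt: "cnj (sgn z) * csqrt z = cnj (csqrt z)"
  using arg_cong[OF sgn_mult_cnj_csqrt[of z], of cnj] by simp

text \<open>Opposite phases make \<open>a\<close> a negative real multiple of \<open>b\<close>, and
  then both products are the same negative real. The disjunction allows for the two directions in
  which a cycle may traverse a given edge.\<close>

lemma sgn_add_sgn_neq_0:
  assumes "a \<noteq> 0" "b \<noteq> 0" "a * cnj b \<notin> neg_reals \<or> cnj a * b \<notin> neg_reals"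
  shows "sgn a + sgn b \<noteq> 0"
proof
  assume "sgn a + sgn b = 0"
  then have "sgn a = - sgn b"
    by (simp add: eq_neg_iff_add_eq_0)
  then have a: "a = - (of_real (cmod a / cmod b) * b)"
    using assms(1,2) by (simp add: sgn_eq field_simps)
  define r where "r = - (cmod a / cmod b * (cmod b)\<^sup>2)"
  have r: "r < 0"
    using assms by (simp add: r_def)
  have "a * cnj b = of_real (- (cmod a / cmod b)) * (b * cnj b)"
    by (subst a) simp
  also have "\<dots> = of_real r"
    by (simp add: r_def flip: complex_norm_square)
  finally have 1: "a * cnj b = of_real r" .
  have "cnj a * b = of_real r"
    using arg_cong[OF 1, of cnj] by simp
  with 1 r assms(3) show False
    by (auto simp: neg_reals_def)
qed

text \<open>Off the cycle, \<open>H\<close> is defined with the reciprocal phase of the path towards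
  the end of the edge. Reversing that path conjugates its weight, and this identity then yields the
  phase of the path from the root.\<close>

lemma cmod_divide_cnj: "complex_of_real (cmod z) / cnj z = sgn z"
proof (cases "z = 0")
  case False
  then show ?thesis
    using complex_norm_square[of z] by (simp add: sgn_eq field_simps power2_eq_square)
qed simp

section \<open>Removing an edge from a unicyclic graph\<close>

lemma in_vwalk_arcs_split:
  assumes "(a, b) \<in> set (vwalk_arcs c)"
  shows "\<exists>p q. c = p @ a # b # q"
  using assms
proof (induction c rule: vwalk_arcs.induct)
  case (3 x y xs)
  show ?case
  proof (cases "(a, b) = (x, y)")
    case True
    then have "x # y # xs = [] @ a # b # xs" by simp
    then show ?thesis by blast
  next
    case False
    then obtain p q where "y # xs = p @ a # b # q"
      using 3 by auto
    then have "x # y # xs = (x # p) @ a # b # q" by simp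
    then show ?thesis by blast
  qed
qed auto

context oriented_graph
begin

lemma arcs_ends_underlying:
  "(a, b) \<in> arcs_ends (underlying G) \<longleftrightarrow> (a, b) \<in> arcs_ends G \<or> (b, a) \<in> arcs_ends G"
  by (auto simp: parcs_mk_symmetric arcs_ends_conv)

lemma arcs_ends_underlying_conv:
  "(a, b) \<in> arcs_ends (underlying G) \<longleftrightarrow>
    (\<exists>k\<in>arcs G. (a, b) = (tail G k, head G k) \<or> (a, b) = (head G k, tail G k))"
  by (auto simp: parcs_mk_symmetric)

lemma arcs_ends_edge_removed:
  "(a, b) \<in> arcs_ends (edge_removed G e) \<longleftrightarrow>
    (\<exists>k\<in>arcs G - {e}. (a, b) = (tail G k, head G k) \<or> (a, b) = (head G k, tail G k))"
  by (auto simp: edge_removed_def parcs_mk_symmetric)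

lemma verts_edge_removed: "verts (edge_removed G e) = verts G"
  by (simp add: edge_removed_def)

lemma arcs_ends_edge_removedD:
  "(a, b) \<in> arcs_ends (edge_removed G e) \<Longrightarrow> (a, b) \<in> arcs_ends (underlying G)"
  unfolding arcs_ends_edge_removed arcs_ends_underlying_conv by blast

lemma vwalk_edge_removedD: "vwalk p (edge_removed G e) \<Longrightarrow> vwalk p (underlying G)"
  using arcs_ends_edge_removedD[of _ _ e] unfolding vwalk_def verts_edge_removed
  by (simp add: subset_iff split_paired_all)

lemma symmetric_edge_removed: "symmetric (edge_removed G e)"
  unfolding edge_removed_def by (rule symmetric_mk_symmetric)

lemma loopfree_edge_removed: "loopfree_digraph (edge_removed G e)"
  by unfold_locales (auto simp: edge_removed_def parcs_mk_symmetric dest: no_loops no_loops[THEN not_sym])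

lemma wf_digraph_underlying: "wf_digraph (underlying G)"
  by unfold_locales (auto simp: parcs_mk_symmetric)

text \<open>A second arc between the same ends would keep them adjacent. A parallel one is excluded
  in a \<open>digraph\<close>, an opposite one by the orientation.\<close>

lemma ends_edge_removed:
  assumes "e \<in> arcs G"
  shows "(tail G e, head G e) \<notin> arcs_ends (edge_removed G e)"
    "(head G e, tail G e) \<notin> arcs_ends (edge_removed G e)"
proof -
  have "\<not> (tail G k, head G k) = (tail G e, head G e)" if "k \<in> arcs G - {e}" for k
    using no_multi_arcs[of k e] assms that by (auto simp: arc_to_ends_def)
  moreover have "\<not> (tail G k, head G k) = (head G e, tail G e)" if "k \<in> arcs G - {e}" for k
    using no_opposite_arcs[of "tail G e" "head G e"] assms that by (force simp: arcs_ends_conv)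
  ultimately show "(tail G e, head G e) \<notin> arcs_ends (edge_removed G e)"
    "(head G e, tail G e) \<notin> arcs_ends (edge_removed G e)"
    unfolding arcs_ends_edge_removed by (metis prod.inject)+
qed

lemma arcs_ends_edge_removedI:
  assumes "(a, b) \<in> arcs_ends (underlying G)"
    "(a, b) \<noteq> (tail G e, head G e)" "(a, b) \<noteq> (head G e, tail G e)"
  shows "(a, b) \<in> arcs_ends (edge_removed G e)"
  using assms unfolding arcs_ends_edge_removed arcs_ends_underlying_conv by auto

lemma walk_edges_edge_removed:
  assumes "vwalk p (edge_removed G e)"
  shows "e \<notin> walk_edges G p"
  using assms ends_edge_removed[of e] by (auto simp: walk_edges_def vwalk_def)

lemma vwalk_edge_removedI:
  assumes "vwalk p (underlying G)" "e \<in> arcs G" "e \<notin> walk_edges G p"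
  shows "vwalk p (edge_removed G e)"
proof -
  have "(a, b) \<in> arcs_ends (edge_removed G e)" if "(a, b) \<in> set (vwalk_arcs p)" for a b
    using that assms by (intro arcs_ends_edge_removedI) (auto simp: walk_edges_def vwalk_def)
  then show ?thesis
    using assms(1) by (auto simp: vwalk_def verts_edge_removed)
qed

section \<open>Weights of walks and of a cycle cut open\<close>

lemma adj_weight_sym: "adj_weight G w j i = cnj (adj_weight G w i j)"
  using no_opposite_arcs[of i j] by (auto simp: adj_weight_def)

lemma walk_weight_snoc:
  assumes "p \<noteq> []"
  shows "walk_weight G w (p @ [b]) = walk_weight G w p * adj_weight G w (last p) b"
  using assms by (simp add: walk_weight_def vwalk_arcs_append)

lemma walk_weight_rev: "walk_weight G w (rev p) = cnj (walk_weight G w p)"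
proof (induction p rule: vwalk_arcs.induct)
  case (3 x y xs)
  have "walk_weight G w (rev (x # y # xs)) = walk_weight G w (rev (y # xs)) * adj_weight G w y x"
    using walk_weight_snoc[of "rev (y # xs)"] by simp
  also have "\<dots> = cnj (walk_weight G w (y # xs)) * cnj (adj_weight G w x y)"
    using 3 adj_weight_sym[of w y x] by simp
  finally show ?case
    by (simp add: walk_weight_def)
qed (auto simp: walk_weight_def)

lemma walk_weight_neq_0:
  assumes "vwalk p (underlying G)" "\<And>u v. (u, v) \<in> arcs_ends G \<Longrightarrow> w u v \<noteq> 0"
  shows "walk_weight G w p \<noteq> 0"
proof -
  have "adj_weight G w i j \<noteq> 0" if "(i, j) \<in> set (vwalk_arcs p)" for i j
    using that assms arcs_ends_underlying[of i j] by (auto simp: vwalk_def adj_weight_def)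
  then show ?thesis
    by (auto simp: walk_weight_def prod_list_zero_iff)
qed

text \<open>The part \<open>Q\<close> of the cycle after the edge and the part \<open>P\<close> up
  to it meet in the base point of \<open>c\<close>, so that joining them goes round the rest of the
  cycle. The resulting path meets each vertex of the cycle once, hence has as many vertices as
  \<open>c\<close> has edges.\<close>

lemma cycle_walk_cut:
  assumes c: "cycle_walk G c" and ab: "(a, b) \<in> set (vwalk_arcs c)"
  obtains q where "vpath q (underlying G)" "hd q = b" "last q = a"
    "length q = vwalk_length c"
    "walk_weight G w c = adj_weight G w a b * walk_weight G w q"
proof -
  obtain p1 p2 where split: "c = (p1 @ [a]) @ (b # p2)"
    using in_vwalk_arcs_split[OF ab] by auto
  define P Q where "P = p1 @ [a]" and "Q = b # p2"
  have PQ: "c = P @ Q" "P \<noteq> []" "Q \<noteq> []" "last P = a" "hd Q = b"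
    by (simp_all add: P_def Q_def split)
  have join: "joinable Q P"
    using c PQ by (auto simp: cycle_walk_def joinable_def)
  have arcs_c: "vwalk_arcs c = vwalk_arcs P @ (a, b) # vwalk_arcs Q"
    using PQ by (simp add: vwalk_arcs_append)
  have arcs_q: "vwalk_arcs (Q \<oplus> P) = vwalk_arcs Q @ vwalk_arcs P"
    by (rule vwalk_join_arcs[OF join])
  have "vwalk (Q \<oplus> P) (underlying G)"
    using c PQ arcs_c arcs_q list.set_sel(2)[of P]
    unfolding cycle_walk_def vwalk_def by (auto simp: vwalk_join_def)
  moreover have "distinct (Q \<oplus> P)"
    using c PQ by (auto simp: cycle_walk_def vwalk_join_def)
  moreover have "hd (Q \<oplus> P) = b" "last (Q \<oplus> P) = a"
    using PQ join by (simp_all add: vwalk_join_def hd_append vwalk_join_last[OF join, unfolded vwalk_join_def])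
  moreover have "length (Q \<oplus> P) = vwalk_length c"
    using PQ by (cases P) (simp_all add: vwalk_join_def)
  moreover have "walk_weight G w c = adj_weight G w a b * walk_weight G w (Q \<oplus> P)"
    by (simp add: walk_weight_def arcs_c arcs_q)
  ultimately show thesis
    using that by (simp add: vpath_def)
qed

end

lemma (in wf_digraph) vwalk_reachable:
  assumes "vwalk p G" "s \<in> set p"
  shows "hd p \<rightarrow>\<^sup>* s"
proof -
  obtain p1 p2 where p: "p = p1 @ s # p2"
    using assms(2) by (meson split_list)
  have "vwalk (p1 @ [s]) G"
    using assms(1) p vwalkI_append_l[of "p1 @ [s]" p2] by simp
  moreover have "hd (p1 @ [s]) = hd p"
    using p by (cases p1) auto
  ultimately show ?thesis
    unfolding reachable_vwalk_conv by (intro exI[of _ "p1 @ [s]"]) simp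
qed

text \<open>The factor of an entry of \<open>H\<close> that varies along its row: each further edge
  multiplies it by the negated phase of the weight of that edge.\<close>

definition signed_phase :: "('a, 'b) pre_digraph \<Rightarrow> ('a \<Rightarrow> 'a \<Rightarrow> complex) \<Rightarrow> 'a vwalk \<Rightarrow> complex" where
  "signed_phase G w p = (-1) ^ vwalk_length p * sgn (walk_weight G w p)"

lemma signed_phase_singleton: "signed_phase G w [x] = 1"
  by (simp add: signed_phase_def walk_weight_def)

context oriented_graph
begin

lemma signed_phase_snoc:
  assumes "p \<noteq> []"
  shows "signed_phase G w (p @ [b]) = - (signed_phase G w p * sgn (adj_weight G w (last p) b))"
proof -
  have "length p = Suc (length p - 1)"
    using assms by (cases p) auto
  then have "(-1 :: complex) ^ length p = - ((-1) ^ (length p - 1))"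
    by (metis power_Suc mult_minus1)
  then show ?thesis
    using assms by (simp add: signed_phase_def walk_weight_snoc sgn_mult)
qed

text \<open>This is the vanishing of an off-diagonal entry of the product. Of the root paths to
  \<open>a\<close> and \<open>b\<close>, one extends the other by the edge between them; which one
  it is decides whether the square root identity or its conjugate applies.\<close>

lemma signed_phase_arc:
  assumes F: "acyclic_component (edge_removed G e) x"
    and a: "x \<rightarrow>\<^sup>*\<^bsub>edge_removed G e\<^esub> a"
    and ab: "(a, b) \<in> arcs_ends G" "(a, b) \<in> arcs_ends (edge_removed G e)"
    and w: "w a b \<notin> neg_reals"
  defines "rp \<equiv> acyclic_component.root_path (edge_removed G e) x"
  shows "signed_phase G w (rp a) * csqrt (w a b) + signed_phase G w (rp b) * csqrt (cnj (w a b)) = 0"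
proof -
  interpret F: acyclic_component "edge_removed G e" x by (fact F)
  have b: "x \<rightarrow>\<^sup>*\<^bsub>edge_removed G e\<^esub> b"
    using a ab(2) by (rule F.reachable_adj_trans)
  have adj: "adj_weight G w a b = w a b" "adj_weight G w b a = cnj (w a b)"
    using ab(1) adj_weight_sym[of w b a] by (simp_all add: adj_weight_def)
  note cnj = csqrt_cnj[OF w]
  consider "rp b = rp a @ [b]" | "rp a = rp b @ [a]"
    using F.root_path_adj[OF a ab(2)] unfolding rp_def by auto
  then show ?thesis
  proof cases
    case 1
    have "signed_phase G w (rp b) = - (signed_phase G w (rp a) * sgn (w a b))"
      using F.root_path[OF a] unfolding 1 by (simp add: signed_phase_snoc adj flip: rp_def)
    then have "signed_phase G w (rp b) * csqrt (cnj (w a b))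
        = - (signed_phase G w (rp a) * (sgn (w a b) * cnj (csqrt (w a b))))"
      by (simp add: cnj)
    then show ?thesis
      by (simp add: sgn_mult_cnj_csqrt)
  next
    case 2
    have "signed_phase G w (rp a) = - (signed_phase G w (rp b) * cnj (sgn (w a b)))"
      using F.root_path[OF b] unfolding 2 by (simp add: signed_phase_snoc adj sgn_cnj flip: rp_def)
    then have "signed_phase G w (rp a) * csqrt (w a b)
        = - (signed_phase G w (rp b) * (cnj (sgn (w a b)) * csqrt (w a b)))"
      by simp
    then show ?thesis
      by (simp add: sgn_cnj_mult_csqrt cnj)
  qed
qed

text \<open>Up to its first use of \<open>e\<close> a walk survives the removal, and at that moment
  it stands at an end of \<open>e\<close>.\<close>

lemma reachable_edge_removed:
  assumes "a \<rightarrow>\<^sup>*\<^bsub>underlying G\<^esub> b"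
  shows "a \<rightarrow>\<^sup>*\<^bsub>edge_removed G e\<^esub> b \<or> a \<rightarrow>\<^sup>*\<^bsub>edge_removed G e\<^esub> tail G e
    \<or> a \<rightarrow>\<^sup>*\<^bsub>edge_removed G e\<^esub> head G e"
proof -
  interpret F: loopfree_digraph "edge_removed G e"
    by (rule loopfree_edge_removed)
  interpret U: wf_digraph "underlying G"
    by (rule wf_digraph_underlying)
  show ?thesis
    using assms
  proof (induction rule: U.reachable_induct)
    case base
    then have "a \<in> verts (edge_removed G e)"
      by (simp add: verts_edge_removed)
    then show ?case by simp
  next
    case (step y z)
    show ?case
    proof (cases "(y, z) \<in> arcs_ends (edge_removed G e)")
      case True
      then show ?thesis
        using step.IH F.reachable_adj_trans[of a y z] by blast
    next
      case False
      then have "y = tail G e \<or> y = head G e"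
        using arcs_ends_edge_removedI[OF step.hyps(2)] by blast
      then show ?thesis
        using step.IH by blast
    qed
  qed
qed

section \<open>Components left by the removal of an edge, on or off the cycle\<close>

lemma unicyclic_walk_edges:
  assumes "unicyclic G" "cycle_walk G c" "cycle_walk G c'"
  shows "walk_edges G c' = walk_edges G c"
  using assms unfolding unicyclic_def by blast

lemma cycle_walk_edge_removedD:
  assumes "vwalk c (edge_removed G e)" "hd c = last c" "distinct (tl c)" "3 \<le> vwalk_length c"
  shows "cycle_walk G c"
  using assms vwalk_edge_removedD unfolding cycle_walk_def by blast

text \<open>A cycle that survives the removal would have the same edges as \<open>c\<close>, among
  them \<open>e\<close>.\<close>

lemma acyclic_component_cycle_edge:
  assumes "unicyclic G" "cycle_walk G c" "e \<in> walk_edges G c" "x \<in> verts G"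
  shows "acyclic_component (edge_removed G e) x"
proof -
  interpret F: loopfree_digraph "edge_removed G e"
    by (rule loopfree_edge_removed)
  show ?thesis
  proof
    show "symmetric (edge_removed G e)"
      by (rule symmetric_edge_removed)
    show "x \<in> verts (edge_removed G e)"
      using assms by (simp add: verts_edge_removed)
    fix c'
    assume c': "vwalk c' (edge_removed G e)" "hd c' = last c'" "distinct (tl c')" "3 \<le> vwalk_length c'"
    then have "walk_edges G c' = walk_edges G c"
      using assms cycle_walk_edge_removedD unicyclic_walk_edges by blast
    then show "\<not> x \<rightarrow>\<^sup>*\<^bsub>edge_removed G e\<^esub> hd c'"
      using walk_edges_edge_removed[OF c'(1)] assms(3) by simp
  qed
qed

text \<open>A surviving cycle has the same edges as \<open>c\<close>, so its first vertex lies on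
  \<open>c\<close>. If \<open>x\<close> reached that vertex, it would belong to the part with the
  cycle.\<close>

lemma acyclic_component_bridge:
  assumes uni: "unicyclic G" and c: "cycle_walk G c" and x: "x \<in> verts G" "x \<notin> unicyclic_part G c e"
  shows "acyclic_component (edge_removed G e) x"
proof -
  interpret F: loopfree_digraph "edge_removed G e"
    by (rule loopfree_edge_removed)
  show ?thesis
  proof
    show "symmetric (edge_removed G e)"
      by (rule symmetric_edge_removed)
    show "x \<in> verts (edge_removed G e)"
      using x by (simp add: verts_edge_removed)
    fix c'
    assume c': "vwalk c' (edge_removed G e)" "hd c' = last c'" "distinct (tl c')" "3 \<le> vwalk_length c'"
    then have cyc: "cycle_walk G c'"
      by (rule cycle_walk_edge_removedD)
    then have eq: "walk_edges G c' = walk_edges G c"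
      using unicyclic_walk_edges[OF uni c] by blast
    obtain a b p where p: "c' = a # b # p"
      using c'(4) by (cases c' rule: vwalk_arcs.cases) auto
    then have "(a, b) \<in> arcs_ends (underlying G)"
      using cyc unfolding cycle_walk_def vwalk_def by (simp only: vwalk_arcs.simps) auto
    then obtain k where k: "k \<in> arcs G"
      "(a, b) = (tail G k, head G k) \<or> (a, b) = (head G k, tail G k)"
      unfolding arcs_ends_underlying_conv by blast
    then have "k \<in> walk_edges G c"
      unfolding eq[symmetric] by (auto simp: walk_edges_def p)
    then have "a \<in> set c"
      using k(2) unfolding walk_edges_def by (auto elim: in_set_vwalk_arcsE)
    then show "\<not> x \<rightarrow>\<^sup>*\<^bsub>edge_removed G e\<^esub> hd c'"
      using x(2) symmetric_reachable[OF symmetric_edge_removed] p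
      unfolding unicyclic_part_def by auto
  qed
qed

lemma connected_underlying:
  assumes "unicyclic G" "a \<in> verts G" "b \<in> verts G"
  shows "a \<rightarrow>\<^sup>*\<^bsub>underlying G\<^esub> b"
  using assms unfolding unicyclic_def connected_def by (auto simp: strongly_connected_def)

text \<open>Connectedness puts at least one end with the cycle. If both were there, a path between
  them that avoids \<open>e\<close> would form with \<open>e\<close> a cycle other than
  \<open>c\<close>.\<close>

lemma bridge_ends:
  assumes uni: "unicyclic G" and c: "cycle_walk G c" and e: "e \<in> arcs G" "e \<notin> walk_edges G c"
  shows "tail G e \<in> unicyclic_part G c e \<longleftrightarrow> head G e \<notin> unicyclic_part G c e"
proof -
  interpret F: loopfree_digraph "edge_removed G e"
    by (rule loopfree_edge_removed)
  let ?u = "tail G e" and ?v = "head G e"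
  have cF: "vwalk c (edge_removed G e)"
    using c e by (intro vwalk_edge_removedI) (auto simp: cycle_walk_def)
  have cne: "c \<noteq> []"
    using cF by (auto simp: vwalk_def)
  have "hd c \<in> verts G"
    using cF cne by (auto simp: vwalk_def verts_edge_removed)
  then have "hd c \<rightarrow>\<^sup>*\<^bsub>underlying G\<^esub> ?u"
    using uni e by (intro connected_underlying) auto
  then have "hd c \<rightarrow>\<^sup>*\<^bsub>edge_removed G e\<^esub> ?u \<or> hd c \<rightarrow>\<^sup>*\<^bsub>edge_removed G e\<^esub> ?v"
    using reachable_edge_removed by blast
  then have one: "?u \<in> unicyclic_part G c e \<or> ?v \<in> unicyclic_part G c e"
    using hd_in_set[OF cne] unfolding unicyclic_part_def by blast
  have False if "?u \<in> unicyclic_part G c e" "?v \<in> unicyclic_part G c e"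
  proof -
    note sym = symmetric_reachable[OF symmetric_edge_removed]
    have reach: "hd c \<rightarrow>\<^sup>*\<^bsub>edge_removed G e\<^esub> j" if j: "j \<in> unicyclic_part G c e" for j
    proof -
      obtain s where s: "s \<in> set c" "s \<rightarrow>\<^sup>*\<^bsub>edge_removed G e\<^esub> j"
        using j unfolding unicyclic_part_def by blast
      show ?thesis
        using F.vwalk_reachable[OF cF s(1)] s(2) by (rule F.reachable_trans)
    qed
    have "?v \<rightarrow>\<^sup>*\<^bsub>edge_removed G e\<^esub> ?u"
      using sym[OF reach[OF that(2)]] reach[OF that(1)] by (rule F.reachable_trans)
    then obtain p where p: "vpath p (edge_removed G e)" "hd p = ?v" "last p = ?u"
      unfolding F.reachable_vpath_conv by blast
    have "?u \<noteq> ?v"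
      using e no_loops by blast
    \<comment> \<open>The ends of \<open>e\<close> are no longer adjacent, so the path has an inner
      vertex and closing it by \<open>e\<close> gives a cycle of length at least 3.\<close>
    moreover have "p \<noteq> [?v, ?u]"
      using p(1) ends_edge_removed[OF e(1)] by (auto simp: vpath_def vwalk_def)
    ultimately have len: "3 \<le> length p"
      using p by (cases p rule: vwalk_arcs.cases) (auto simp: vpath_def vwalk_def Suc_le_eq)
    have pG: "vwalk p (underlying G)" "distinct p" "p \<noteq> []"
      using p(1) vwalk_edge_removedD by (auto simp: vpath_def vwalk_def)
    have arc: "(?u, ?v) \<in> arcs_ends (underlying G)"
      using e(1) unfolding arcs_ends_underlying_conv by blast
    have "vwalk (?u # p) (underlying G)"
      using pG arc p(2) e(1) by (intro vwalk_consI) auto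
    then have "cycle_walk G (?u # p)"
      using pG p len by (auto simp: cycle_walk_def)
    then have "walk_edges G (?u # p) = walk_edges G c"
      using unicyclic_walk_edges[OF uni c] by blast
    moreover have "e \<in> walk_edges G (?u # p)"
      using e(1) pG(3) p(2) by (simp add: walk_edges_def)
    ultimately show False
      using e(2) by simp
  qed
  then show ?thesis using one by blast
qed

text \<open>The two alternatives for the weight correspond to \<open>c\<close> traversing
  \<open>e\<close> along or against its direction.\<close>

lemma cycle_cut_edge_removed:
  assumes c: "cycle_walk G c" and e: "e \<in> walk_edges G c"
  obtains q where "vpath q (edge_removed G e)" "hd q = tail G e" "last q = head G e"
    "length q = vwalk_length c"
    "walk_weight G w c = w (tail G e) (head G e) * cnj (walk_weight G w q)
      \<or> walk_weight G w c = cnj (w (tail G e) (head G e)) * walk_weight G w q"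
proof -
  let ?u = "tail G e" and ?v = "head G e"
  interpret F: loopfree_digraph "edge_removed G e"
    by (rule loopfree_edge_removed)
  have eG: "e \<in> arcs G"
    using e by (auto simp: walk_edges_def)
  then have "(?u, ?v) \<in> arcs_ends G"
    by (auto simp: arcs_ends_conv)
  then have adj: "adj_weight G w ?u ?v = w ?u ?v" "adj_weight G w ?v ?u = cnj (w ?u ?v)"
    using adj_weight_sym[of w ?v ?u] by (simp_all add: adj_weight_def)
  have len: "3 \<le> vwalk_length c"
    using c by (simp add: cycle_walk_def)
  \<comment> \<open>A path from \<open>b\<close> to \<open>a\<close> can use the edge between them
    only by consisting of it alone, and \<open>q\<close> has at least three vertices.\<close>
  have avoid: "vwalk q (edge_removed G e)"
    if q: "vpath q (underlying G)" "hd q = b" "last q = a" "length q = vwalk_length c"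
      and ab: "(a, b) = (?u, ?v) \<or> (a, b) = (?v, ?u)" for q a b
  proof -
    have d: "distinct q" "vwalk q (underlying G)"
      using q(1) by (auto simp: vpath_def)
    have "(a, b) \<notin> set (vwalk_arcs q)"
    proof
      assume "(a, b) \<in> set (vwalk_arcs q)"
      from in_vwalk_arcs_split[OF this] obtain p1 p2 where split: "q = p1 @ a # b # p2"
        by metis
      then have "last (b # p2) = a"
        using q(3) by simp
      then have "a \<in> set (b # p2)"
        using last_in_set[of "b # p2"] by simp
      then show False
        using d(1) unfolding split by simp
    qed
    moreover have "(b, a) \<notin> set (vwalk_arcs q)"
    proof
      assume "(b, a) \<in> set (vwalk_arcs q)"
      from in_vwalk_arcs_split[OF this] obtain p1 p2 where split: "q = p1 @ b # a # p2"
        by metis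
      have "p1 = []"
      proof (rule ccontr)
        assume p1: "p1 \<noteq> []"
        then have "b \<in> set p1"
          using q(2) split hd_in_set[OF p1] by simp
        then show False
          using d(1) unfolding split by simp
      qed
      moreover have "p2 = []"
      proof (rule ccontr)
        assume p2: "p2 \<noteq> []"
        then have "a \<in> set p2"
          using q(3) split last_in_set[OF p2] by simp
        then show False
          using d(1) unfolding split by simp
      qed
      ultimately show False
        using split q(4) len by simp
    qed
    ultimately have "e \<notin> walk_edges G q"
      using ab by (auto simp: walk_edges_def)
    then show ?thesis
      using vwalk_edge_removedI[OF d(2) eG] by blast
  qed
  consider "(?u, ?v) \<in> set (vwalk_arcs c)" | "(?v, ?u) \<in> set (vwalk_arcs c)"
    using e by (auto simp: walk_edges_def)
  then show thesis
  proof cases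
    case 1
    obtain q where q: "vpath q (underlying G)" "hd q = ?v" "last q = ?u" "length q = vwalk_length c"
      "walk_weight G w c = adj_weight G w ?u ?v * walk_weight G w q"
      using cycle_walk_cut[OF c 1] by metis
    \<comment> \<open>Here \<open>q\<close> leads from head to tail, so it is reversed, which
      conjugates its weight.\<close>
    have "vwalk (rev q) (edge_removed G e)"
      using avoid[OF q(1-4)] vwalk_rev_ex[OF symmetric_edge_removed] by blast
    moreover have "distinct (rev q)" "q \<noteq> []"
      using q(1) by (auto simp: vpath_def vwalk_def)
    ultimately show thesis
      using q adj by (intro that[of "rev q"]) (auto simp: vpath_def hd_rev last_rev walk_weight_rev)
  next
    case 2
    obtain q where q: "vpath q (underlying G)" "hd q = ?u" "last q = ?v" "length q = vwalk_length c"
      "walk_weight G w c = adj_weight G w ?v ?u * walk_weight G w q"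
      using cycle_walk_cut[OF c 2] by metis
    have "vwalk q (edge_removed G e)"
      using avoid[OF q(1-4)] by blast
    then show thesis
      using q adj by (intro that[of q]) (auto simp: vpath_def)
  qed
qed

lemma star_root_path:
  assumes F: "acyclic_component (edge_removed G e) x"
    and j: "x \<rightarrow>\<^sup>*\<^bsub>edge_removed G e\<^esub> j"
  defines "rp \<equiv> acyclic_component.root_path (edge_removed G e) x"
  shows "dist_star G e j x = vwalk_length (rp j)" "path_star G e x j = rp j"
    "path_star G e j x = rev (rp j)"
proof -
  interpret F: acyclic_component "edge_removed G e" x by (fact F)
  show "dist_star G e j x = vwalk_length (rp j)"
    unfolding dist_star_def rp_def by (rule F.dist_to_root[OF j])
  show "path_star G e x j = rp j"
    unfolding path_star_def rp_def F.root_path_def ..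
  show "path_star G e j x = rev (rp j)"
    unfolding path_star_def rp_def by (rule F.path_to_root[OF j])
qed

lemma unicyclic_part_reachable:
  assumes "j \<in> unicyclic_part G c e" "x \<rightarrow>\<^sup>*\<^bsub>edge_removed G e\<^esub> j"
  shows "x \<in> unicyclic_part G c e"
proof -
  interpret F: loopfree_digraph "edge_removed G e"
    by (rule loopfree_edge_removed)
  obtain s where s: "s \<in> set c" "s \<rightarrow>\<^sup>*\<^bsub>edge_removed G e\<^esub> j"
    using assms(1) unfolding unicyclic_part_def by blast
  have "s \<rightarrow>\<^sup>*\<^bsub>edge_removed G e\<^esub> x"
    using s(2) symmetric_reachable[OF symmetric_edge_removed assms(2)] by (rule F.reachable_trans)
  then show ?thesis
    using s(1) unfolding unicyclic_part_def by blast
qed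

text \<open>Without \<open>e\<close> every vertex still reaches one end of \<open>e\<close>, and the
  rest of the cycle joins the two ends.\<close>

lemma connected_cycle_edge_removed:
  assumes uni: "unicyclic G" and c: "cycle_walk G c" and e: "e \<in> walk_edges G c"
    and j: "j \<in> verts G"
  shows "tail G e \<rightarrow>\<^sup>*\<^bsub>edge_removed G e\<^esub> j"
proof -
  interpret F: loopfree_digraph "edge_removed G e"
    by (rule loopfree_edge_removed)
  obtain q where "vpath q (edge_removed G e)" "hd q = tail G e" "last q = head G e"
    using cycle_cut_edge_removed[OF c e] by metis
  then have uv: "tail G e \<rightarrow>\<^sup>*\<^bsub>edge_removed G e\<^esub> head G e"
    unfolding F.reachable_vpath_conv by blast
  have "tail G e \<in> verts G"
    using e by (auto simp: walk_edges_def)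
  then have "j \<rightarrow>\<^sup>*\<^bsub>edge_removed G e\<^esub> tail G e \<or> j \<rightarrow>\<^sup>*\<^bsub>edge_removed G e\<^esub> head G e"
    using reachable_edge_removed[OF connected_underlying[OF uni j]] by blast
  then have "j \<rightarrow>\<^sup>*\<^bsub>edge_removed G e\<^esub> tail G e"
    using F.reachable_trans[OF _ symmetric_reachable[OF symmetric_edge_removed uv]] by blast
  then show ?thesis
    by (rule symmetric_reachable[OF symmetric_edge_removed])
qed

end

section \<open>The rows of \<open>H\<close>\<close>

text \<open>On the component of a suitable end \<open>x\<close> of edge \<open>i\<close>, the row \<open>i\<close> of \<open>H\<close> is a multiple of the
  signed phase of the path from \<open>x\<close>, whichever case of the definition of \<open>H\<close> applies.\<close>

lemma H_matrix_row:
  fixes G :: "(nat, nat) pre_digraph"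
  assumes G: "oriented_graph G" "verts G = {0..<n}" "arcs G = {0..<n}" "unicyclic G"
    and w: "\<And>u v. (u, v) \<in> arcs_ends G \<Longrightarrow> w u v \<noteq> 0 \<and> w u v \<notin> neg_reals"
    and c: "cycle_walk G c" "odd (vwalk_length c)" "walk_weight G w c \<notin> neg_reals"
    and i: "i < n"
  obtains x K where "acyclic_component (edge_removed G i) x"
    "\<And>j. j < n \<Longrightarrow> H_matrix n G w c $$ (i, j) =
      (if x \<rightarrow>\<^sup>*\<^bsub>edge_removed G i\<^esub> j
       then K * signed_phase G w (acyclic_component.root_path (edge_removed G i) x j) else 0)"
    "H_matrix n G w c $$ (i, tail G i) * csqrt (w (tail G i) (head G i)) +
      H_matrix n G w c $$ (i, head G i) * csqrt (cnj (w (tail G i) (head G i))) = 1"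
proof -
  interpret oriented_graph G by (fact G(1))
  define u v where "u = tail G i" and "v = head G i"
  let ?F = "edge_removed G i" and ?H = "H_matrix n G w c"
  have iG: "i \<in> arcs G"
    using G(3) i by simp
  have uvG: "u \<in> verts G" "v \<in> verts G" and uvn: "u < n" "v < n"
    using iG G(2) wellformed[of i] by (auto simp: u_def v_def)
  have arc: "(u, v) \<in> arcs_ends G"
    using iG by (auto simp: u_def v_def arcs_ends_conv)
  have w0: "w u v \<noteq> 0" and wneg: "w u v \<notin> neg_reals"
    using w[OF arc] by auto
  have s0: "csqrt (w u v) \<noteq> 0" "csqrt (cnj (w u v)) \<noteq> 0"
    using w0 by simp_all
  show thesis
  proof (cases "i \<in> walk_edges G c")
    case True
    have F: "acyclic_component ?F u"
      using G(4) c(1) True uvG by (intro acyclic_component_cycle_edge)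
    interpret F: acyclic_component ?F u by (fact F)
    have conn: "u \<rightarrow>\<^sup>*\<^bsub>?F\<^esub> j" if "j < n" for j
      using connected_cycle_edge_removed[OF G(4) c(1) True] that G(2) unfolding u_def by simp
    obtain q where q: "vpath q ?F" "hd q = u" "last q = v" "length q = vwalk_length c"
      "walk_weight G w c = w u v * cnj (walk_weight G w q)
        \<or> walk_weight G w c = cnj (w u v) * walk_weight G w q"
      using cycle_cut_edge_removed[OF c(1) True, where w = w] unfolding u_def v_def by metis
    have rv: "F.root_path v = q"
      using q by (intro F.root_path_eqI)
    \<comment> \<open>\<open>D\<close> is the sum of phases in the denominator of \<open>H\<close>.
      Up to conjugating one factor, the cycle weight is the product of the two weights in
      \<open>D\<close>, so the hypothesis on that weight keeps \<open>D\<close> from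
      vanishing.\<close>
    define D where "D = sgn (w u v) + sgn (walk_weight G w q)"
    define K where "K = 1 / (csqrt (cnj (w u v)) * D)"
    have "walk_weight G w q \<noteq> 0"
      using q(1) w vwalk_edge_removedD by (intro walk_weight_neq_0) (auto simp: vpath_def)
    then have D0: "D \<noteq> 0"
      unfolding D_def using w0 c(3) q(5) by (intro sgn_add_sgn_neq_0) auto
    have s: "csqrt (w u v) = csqrt (cnj (w u v)) * sgn (w u v)"
      using sgn_mult_cnj_csqrt[of "w u v"] csqrt_cnj[OF wneg] by (simp add: mult.commute)
    have H: "?H $$ (i, j) = K * signed_phase G w (F.root_path j)" if "j < n" for j
      using True i that star_root_path[OF F conn[OF that]] star_root_path[OF F conn[OF uvn(2)]] rv
      by (simp add: H_matrix_def Let_def signed_phase_def K_def D_def sgn_eq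
        flip: u_def v_def)
    \<comment> \<open>\<open>q\<close> lacks one edge of the odd cycle, so both ends of edge
      \<open>i\<close> get the sign +1.\<close>
    have "even (vwalk_length q)"
      using c(2) q(4) by (cases q) auto
    then have "signed_phase G w q = sgn (walk_weight G w q)"
      by (simp add: signed_phase_def)
    then have "?H $$ (i, u) * csqrt (w u v) + ?H $$ (i, v) * csqrt (cnj (w u v))
        = K * (csqrt (w u v) + csqrt (cnj (w u v)) * sgn (walk_weight G w q))"
      using H[OF uvn(1)] H[OF uvn(2)] rv F.root_path_root signed_phase_singleton[of G w u]
      by (simp add: algebra_simps)
    also have "\<dots> = K * (csqrt (cnj (w u v)) * D)"
      by (simp only: s D_def distrib_left)
    also have "\<dots> = 1"
      using s0(2) D0 by (simp add: K_def)
    finally have "?H $$ (i, u) * csqrt (w u v) + ?H $$ (i, v) * csqrt (cnj (w u v)) = 1" .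
    then show thesis
      using H conn by (intro that[OF F, of K]) (simp_all add: u_def v_def)
  next
    case False
    have bridge: "u \<in> unicyclic_part G c i \<longleftrightarrow> v \<notin> unicyclic_part G c i"
      using bridge_ends[OF G(4) c(1) iG False] unfolding u_def v_def .
    note part = unicyclic_part_reachable[of _ c i]
    show thesis
    proof (cases "u \<in> unicyclic_part G c i")
      \<comment> \<open>The tail lies in the tree and its root path is trivial, while the row
        vanishes at the head. Only \<open>1 / csqrt (w u v)\<close> times
        \<open>csqrt (w u v)\<close> remains.\<close>
      case u: False
      have v: "v \<in> unicyclic_part G c i"
        using bridge u by simp
      have F: "acyclic_component ?F u"
        by (rule acyclic_component_bridge[OF G(4) c(1) uvG(1) u])
      interpret F: acyclic_component ?F u by (fact F)
      have H: "?H $$ (i, j) = (if u \<rightarrow>\<^sup>*\<^bsub>?F\<^esub> j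
          then 1 / csqrt (w u v) * signed_phase G w (F.root_path j) else 0)" if "j < n" for j
        using False i that u v part[of j u] star_root_path[OF F, of j]
        by (auto simp: H_matrix_def Let_def signed_phase_def tree_part_def walk_weight_rev
            cmod_divide_cnj simp flip: u_def v_def)
      have "\<not> u \<rightarrow>\<^sup>*\<^bsub>?F\<^esub> v"
        using part[OF v] u by blast
      then have "?H $$ (i, u) * csqrt (w u v) + ?H $$ (i, v) * csqrt (cnj (w u v)) = 1"
        using H[OF uvn(1)] H[OF uvn(2)] F.root_path_root signed_phase_singleton[of G w u] s0 F.root
        by simp
      then show thesis
        using H by (intro that[OF F, of "1 / csqrt (w u v)"]) (simp_all add: u_def v_def)
    next
      \<comment> \<open>The mirror case: the tree hangs at the head, whose entry in the incidence
        matrix is the root of the conjugate weight.\<close>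
      case u: True
      have v: "v \<notin> unicyclic_part G c i"
        using bridge u by simp
      have F: "acyclic_component ?F v"
        by (rule acyclic_component_bridge[OF G(4) c(1) uvG(2) v])
      interpret F: acyclic_component ?F v by (fact F)
      have H: "?H $$ (i, j) = (if v \<rightarrow>\<^sup>*\<^bsub>?F\<^esub> j
          then 1 / csqrt (cnj (w u v)) * signed_phase G w (F.root_path j) else 0)" if "j < n" for j
        using False i that u v part[of j v] star_root_path[OF F, of j]
        by (auto simp: H_matrix_def Let_def signed_phase_def tree_part_def walk_weight_rev
            cmod_divide_cnj simp flip: u_def v_def)
      have "\<not> v \<rightarrow>\<^sup>*\<^bsub>?F\<^esub> u"
        using part[OF u] v by blast
      then have "?H $$ (i, u) * csqrt (w u v) + ?H $$ (i, v) * csqrt (cnj (w u v)) = 1"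
        using H[OF uvn(1)] H[OF uvn(2)] F.root_path_root signed_phase_singleton[of G w v] s0 F.root
        by simp
      then show thesis
        using H by (intro that[OF F, of "1 / csqrt (cnj (w u v))"]) (simp_all add: u_def v_def)
    qed
  qed
qed

section \<open>Products with the incidence matrix and inverses of square matrices\<close>

lemma signless_incidence_mult_entry:
  assumes "loopfree_digraph G" "verts G = {0..<n}" "arcs G = {0..<n}"
    and "A \<in> carrier_mat n n" "i < n" "k < n"
  shows "(A * signless_incidence n G w) $$ (i, k) =
    A $$ (i, tail G k) * csqrt (w (tail G k) (head G k)) +
    A $$ (i, head G k) * csqrt (cnj (w (tail G k) (head G k)))"
proof -
  interpret loopfree_digraph G by (fact assms(1))
  let ?u = "tail G k" and ?v = "head G k"
  have uv: "?u \<in> {0..<n}" "?v \<in> {0..<n}" "?u \<noteq> ?v"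
    using assms wellformed[of k] no_loops[of k] by auto
  have "(A * signless_incidence n G w) $$ (i, k) =
      (\<Sum>j\<in>{0..<n}. A $$ (i, j) * (if j = ?u then csqrt (w ?u ?v) else if j = ?v then csqrt (cnj (w ?u ?v)) else 0))"
    using assms by (auto simp: signless_incidence_def scalar_prod_def Let_def intro!: sum.cong)
  also have "\<dots> = (\<Sum>j\<in>{?u, ?v}. A $$ (i, j) *
      (if j = ?u then csqrt (w ?u ?v) else if j = ?v then csqrt (cnj (w ?u ?v)) else 0))"
    using uv by (intro sum.mono_neutral_right) auto
  also have "\<dots> = A $$ (i, ?u) * csqrt (w ?u ?v) + A $$ (i, ?v) * csqrt (cnj (w ?u ?v))"
    using uv(3) by simp
  finally show ?thesis .
qed

lemma mat_adjoint_one: "mat_adjoint (1\<^sub>m n :: complex mat) = 1\<^sub>m n"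
  by (rule eq_matI) (auto simp: mat_adjoint_def mat_of_rows_def)

text \<open>A left inverse of a square matrix is two-sided, and the identity is its own
  adjoint.\<close>

lemma is_moore_penrose_inverseI_inverse:
  assumes "A \<in> carrier_mat n n" "X \<in> carrier_mat n n" "X * A = 1\<^sub>m n"
  shows "is_moore_penrose_inverse A X"
proof -
  have "A * X = 1\<^sub>m n"
    using mat_mult_left_right_inverse[OF assms(2,1,3)] .
  then show ?thesis
    using assms by (auto simp: is_moore_penrose_inverse_def mat_adjoint_one)
qed

theorem theorem3p7:
  fixes n :: nat
    and G :: "(nat, nat) pre_digraph"
    and w :: "nat \<Rightarrow> nat \<Rightarrow> complex"
    and c :: "nat vwalk"
  assumes "n \<ge> 2"
    and "oriented_graph G"
    and "verts G = {0..<n}"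
    and "arcs G = {0..<n}"
    and "unicyclic G"
    and "\<And>u v. (u, v) \<in> arcs_ends G \<Longrightarrow> w u v \<noteq> 0 \<and> w u v \<notin> neg_reals"
    and "cycle_walk G c"
    and "odd (vwalk_length c)"
    and "walk_weight G w c \<notin> neg_reals"
  shows "is_moore_penrose_inverse (signless_incidence n G w) (H_matrix n G w c)"
proof (rule is_moore_penrose_inverseI_inverse)
  interpret oriented_graph G by (fact assms(2))
  let ?N = "signless_incidence n G w" and ?H = "H_matrix n G w c"
  show N: "?N \<in> carrier_mat n n" and H: "?H \<in> carrier_mat n n"
    by (simp_all add: signless_incidence_def H_matrix_def)
  show "?H * ?N = 1\<^sub>m n"
  proof (rule eq_matI)
    fix i k assume "i < dim_row (1\<^sub>m n :: complex mat)" "k < dim_col (1\<^sub>m n :: complex mat)"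
    then have ik: "i < n" "k < n" by auto
    define a b where "a = tail G k" and "b = head G k"
    have k: "k \<in> arcs G"
      using ik assms(4) by simp
    then have ab: "a < n" "b < n" "(a, b) \<in> arcs_ends G"
      using wellformed[of k] assms(3) by (auto simp: a_def b_def arcs_ends_conv)
    have entry: "(?H * ?N) $$ (i, k) = ?H $$ (i, a) * csqrt (w a b) + ?H $$ (i, b) * csqrt (cnj (w a b))"
      unfolding a_def b_def
      by (rule signless_incidence_mult_entry[OF _ assms(3,4) H ik]) unfold_locales
    obtain x K where xK: "acyclic_component (edge_removed G i) x"
      "\<And>j. j < n \<Longrightarrow> ?H $$ (i, j) = (if x \<rightarrow>\<^sup>*\<^bsub>edge_removed G i\<^esub> j
        then K * signed_phase G w (acyclic_component.root_path (edge_removed G i) x j) else 0)"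
      "?H $$ (i, tail G i) * csqrt (w (tail G i) (head G i)) +
        ?H $$ (i, head G i) * csqrt (cnj (w (tail G i) (head G i))) = 1"
      using H_matrix_row[OF assms(2-9) ik(1)] by blast
    interpret F: acyclic_component "edge_removed G i" x by (fact xK(1))
    show "(?H * ?N) $$ (i, k) = (1\<^sub>m n :: complex mat) $$ (i, k)"
    proof (cases "k = i")
      case True
      then show ?thesis
        using entry xK(3) ik by (simp add: a_def b_def)
    next
      case False
      have abF: "(a, b) \<in> arcs_ends (edge_removed G i)"
        using k False unfolding arcs_ends_edge_removed a_def b_def by blast
      \<comment> \<open>Edge \<open>k\<close> survives the removal of \<open>i\<close>, so its ends
        share a component: either both entries of the row vanish or both are given by root
        paths.\<close>
      have reach: "x \<rightarrow>\<^sup>*\<^bsub>edge_removed G i\<^esub> a \<longleftrightarrow> x \<rightarrow>\<^sup>*\<^bsub>edge_removed G i\<^esub> b"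
        using F.reachable_adj_trans[of x a b] F.reachable_adj_trans[of x b a] abF
          arcs_ends_symmetric[OF F.sym abF] by blast
      have "(?H * ?N) $$ (i, k) = 0"
      proof (cases "x \<rightarrow>\<^sup>*\<^bsub>edge_removed G i\<^esub> a")
        case True
        have "(?H * ?N) $$ (i, k) = K * (signed_phase G w (F.root_path a) * csqrt (w a b)
            + signed_phase G w (F.root_path b) * csqrt (cnj (w a b)))"
          using entry xK(2) ab reach True by (simp add: algebra_simps)
        also have "\<dots> = 0"
          using signed_phase_arc[OF xK(1) True ab(3) abF] assms(6)[OF ab(3)] by simp
        finally show ?thesis .
      next
        case False
        then show ?thesis
          using entry xK(2) ab reach by simp
      qed
      then show ?thesis
        using False ik by simp
    qed
  qed (simp_all add: signless_incidence_def H_matrix_def)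
qed

end
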